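(* Let $M$ be a positive integer and let $X_i,Y_i\in\mathbb{R}$ be given for all $i=1,\ldots,M$, where $X_i\ne0$ for at least one $i$. Consider the problem of finding $\theta_1,\theta_2\in\mathbb{R}$ that achieve $$\min_{\theta_1,\theta_2}\ \max_{1\le i\le M}|\theta_1+X_i\theta_2-Y_i|.$$ The minimum error (the minimum value of the objective function) in this problem is equal to $$\mu=\max_{\substack{1\le i<k\le M\\ |X_i|+|X_k|\ne 0}}\ \max_{\substack{1\le p<r\le M\\ X_r\ne X_p}}\frac{\left|(Y_iX_k-Y_kX_i)(X_r-X_p)-(Y_pX_r-Y_rX_p)(X_k-X_i)\right|}{(|X_i|+|X_k|)\,|X_r-X_p|+(|X_p|+|X_r|)\,|X_k-X_i|},$$ and all solutions of the problem are given by the conditions $$\max_{\substack{1\le i<k\le M\\ X_k\ne X_i}}\left(-\frac{|X_i|+|X_k|}{|X_k-X_i|}\mu+\frac{Y_iX_k-Y_kX_i}{X_k-X_i}\right)\le\theta_1\le\min_{\substack{1\le i<k\le M\\ X_k\ne X_i}}\left(\frac{|X_i|+|X_k|}{|X_k-X_i|}\mu+\frac{Y_iX_k-Y_kX_i}{X_k-X_i}\right),$$ $$\max_{\substack{1\le i\le M\\ X_i\ne 0}}\left(-\frac{\mu}{|X_i|}-\frac{\theta_1}{X_i}+\frac{Y_i}{X_i}\right)\le\theta_2\le\min_{\substack{1\le i\le M\\ X_i\ne 0}}\left(\frac{\mu}{|X_i|}-\frac{\theta_1}{X_i}+\frac{Y_i}{X_i}\right).$$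
   Context: This is the two-parameter linear regression problem under the least maximum absolute deviation (Chebyshev) criterion, with intercept $\theta_1$ and slope $\theta_2$.
   Formalization: Adds the condition that if all X_i are equal then all Y_i are equal (otherwise the formula for μ is an empty maximum: X=(1,1), Y=(0,1) has minimum 1/2); with all X_i equal, μ is read as 0 and θ_1 as unconstrained. *)

theory Defs
  imports Complex_Main "HOL-Library.Extended_Real"
begin

definition max_error :: "nat \<Rightarrow> (nat \<Rightarrow> real) \<Rightarrow> (nat \<Rightarrow> real) \<Rightarrow> real \<times> real \<Rightarrow> real" where
  "max_error M X Y = (\<lambda>(\<theta>\<^sub>1, \<theta>\<^sub>2). Max ((\<lambda>i. \<bar>\<theta>\<^sub>1 + X i * \<theta>\<^sub>2 - Y i\<bar>) ` {1..M}))"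

definition nonzero_pairs :: "nat \<Rightarrow> (nat \<Rightarrow> real) \<Rightarrow> (nat \<times> nat) set" where
  "nonzero_pairs M X = {(i, k). 1 \<le> i \<and> i < k \<and> k \<le> M \<and> \<bar>X i\<bar> + \<bar>X k\<bar> \<noteq> 0}"

definition distinct_pairs :: "nat \<Rightarrow> (nat \<Rightarrow> real) \<Rightarrow> (nat \<times> nat) set" where
  "distinct_pairs M X = {(p, r). 1 \<le> p \<and> p < r \<and> r \<le> M \<and> X r \<noteq> X p}"

(* distinct_pairs M X is empty iff all abscissas coincide (in particular for M = 1).
   All the quotients are nonnegative, so a maximum over no quotients is 0.
   If distinct_pairs M X is nonempty, so is its superset nonzero_pairs M X.
   When all abscissas coincide, the formula no longer depends on Y, so it can equal the
   minimum (max Y - min Y) / 2 only if Y is constant as well: for X = (1, 1), Y = (0, 1)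
   the minimum is 1/2. *)
definition error_mu :: "nat \<Rightarrow> (nat \<Rightarrow> real) \<Rightarrow> (nat \<Rightarrow> real) \<Rightarrow> real" where
  "error_mu M X Y =
    (if distinct_pairs M X = {} then 0
     else Max ((\<lambda>(i, k). Max ((\<lambda>(p, r).
            \<bar>(Y i * X k - Y k * X i) * (X r - X p) - (Y p * X r - Y r * X p) * (X k - X i)\<bar>
            / ((\<bar>X i\<bar> + \<bar>X k\<bar>) * \<bar>X r - X p\<bar> + (\<bar>X p\<bar> + \<bar>X r\<bar>) * \<bar>X k - X i\<bar>))
          ` distinct_pairs M X)) ` nonzero_pairs M X))"

(* Extended reals: with no distinct pairs the bounds are -\<infinity> and \<infinity>,
   i.e. there is no constraint. *)
definition intercept_lower :: "nat \<Rightarrow> (nat \<Rightarrow> real) \<Rightarrow> (nat \<Rightarrow> real) \<Rightarrow> real \<Rightarrow> ereal" where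
  "intercept_lower M X Y \<mu> =
    (SUP (i, k)\<in>distinct_pairs M X.
      ereal (- ((\<bar>X i\<bar> + \<bar>X k\<bar>) / \<bar>X k - X i\<bar>) * \<mu> + (Y i * X k - Y k * X i) / (X k - X i)))"

definition intercept_upper :: "nat \<Rightarrow> (nat \<Rightarrow> real) \<Rightarrow> (nat \<Rightarrow> real) \<Rightarrow> real \<Rightarrow> ereal" where
  "intercept_upper M X Y \<mu> =
    (INF (i, k)\<in>distinct_pairs M X.
      ereal ((\<bar>X i\<bar> + \<bar>X k\<bar>) / \<bar>X k - X i\<bar> * \<mu> + (Y i * X k - Y k * X i) / (X k - X i)))"

definition slope_lower :: "nat \<Rightarrow> (nat \<Rightarrow> real) \<Rightarrow> (nat \<Rightarrow> real) \<Rightarrow> real \<Rightarrow> real \<Rightarrow> real" where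
  "slope_lower M X Y \<mu> \<theta>\<^sub>1 =
    Max ((\<lambda>i. - (\<mu> / \<bar>X i\<bar>) - \<theta>\<^sub>1 / X i + Y i / X i) ` {i\<in>{1..M}. X i \<noteq> 0})"

definition slope_upper :: "nat \<Rightarrow> (nat \<Rightarrow> real) \<Rightarrow> (nat \<Rightarrow> real) \<Rightarrow> real \<Rightarrow> real \<Rightarrow> real" where
  "slope_upper M X Y \<mu> \<theta>\<^sub>1 =
    Min ((\<lambda>i. \<mu> / \<bar>X i\<bar> - \<theta>\<^sub>1 / X i + Y i / X i) ` {i\<in>{1..M}. X i \<noteq> 0})"

end

theory Submission
  imports Defs
begin

text \<open>
  Fourier--Motzkin elimination. An error bound \<open>e\<close> is feasible iff the strips
  \<open>\<bar>Y i - \<theta>\<^sub>1 - \<theta>\<^sub>2 * X i\<bar> \<le> e\<close> have a common point. Eliminating \<open>\<theta>\<^sub>2\<close> from two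
  strips gives \<open>\<bar>(Y i * X k - Y k * X i) - \<theta>\<^sub>1 * (X k - X i)\<bar> \<le> e * (\<bar>X i\<bar> + \<bar>X k\<bar>)\<close>.
  If \<open>X k \<noteq> X i\<close>, this is an interval for \<open>\<theta>\<^sub>1\<close>, and if \<open>X k = X i \<noteq> 0\<close>, it is a
  condition on \<open>e\<close> alone. Eliminating \<open>\<theta>\<^sub>1\<close> from two such inequalities gives the quotients in
  \<open>error_mu\<close>. A point with \<open>X i = 0\<close> does not constrain \<open>\<theta>\<^sub>2\<close>; its strip is the inequality for
  the pair formed with any \<open>k\<close> such that \<open>X k \<noteq> 0\<close>.
\<close>

section \<open>Strips in one unknown\<close>

lemma abs_diff_mult_le_iff:
  fixes a c d e w :: real
  assumes "d \<noteq> 0"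
  shows "\<bar>c - a * d\<bar> \<le> e * w \<longleftrightarrow> - (w / \<bar>d\<bar>) * e + c / d \<le> a \<and> a \<le> w / \<bar>d\<bar> * e + c / d"
proof -
  have "\<bar>c - a * d\<bar> = \<bar>c / d - a\<bar> * \<bar>d\<bar>"
    using assms by (simp add: abs_mult[symmetric] left_diff_distrib)
  then have "\<bar>c - a * d\<bar> \<le> e * w \<longleftrightarrow> \<bar>c / d - a\<bar> \<le> e * w / \<bar>d\<bar>"
    using assms by (simp add: pos_le_divide_eq)
  then show ?thesis
    by (simp add: abs_le_iff mult.commute) linarith
qed

text \<open>One-dimensional Helly argument: \<open>cross\<close> says, after clearing denominators,
  that no lower endpoint exceeds an upper endpoint, so the largest lower endpoint lies in every
  interval. It serves to find first the intercept and then the slope.\<close>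

lemma strips_intersect:
  fixes c d w :: "'a \<Rightarrow> real"
  assumes "finite S" and "S \<noteq> {}" and d: "\<And>i. i \<in> S \<Longrightarrow> d i \<noteq> 0"
    and cross: "\<And>i j. i \<in> S \<Longrightarrow> j \<in> S \<Longrightarrow>
      \<bar>c i * d j - c j * d i\<bar> \<le> e * (w i * \<bar>d j\<bar> + w j * \<bar>d i\<bar>)"
  shows "\<exists>a. \<forall>i\<in>S. \<bar>c i - a * d i\<bar> \<le> e * w i"
proof -
  define l where "l i = - (w i / \<bar>d i\<bar>) * e + c i / d i" for i
  define u where "u i = w i / \<bar>d i\<bar> * e + c i / d i" for i
  have "l i \<le> u j" if "i \<in> S" "j \<in> S" for i j
  proof -
    have "c i / d i - c j / d j = (c i * d j - c j * d i) / (d i * d j)"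
      using d that by (simp add: field_simps)
    also have "\<dots> \<le> \<bar>c i * d j - c j * d i\<bar> / (\<bar>d i\<bar> * \<bar>d j\<bar>)"
      by (metis abs_divide abs_ge_self abs_mult)
    also have "\<dots> \<le> e * (w i * \<bar>d j\<bar> + w j * \<bar>d i\<bar>) / (\<bar>d i\<bar> * \<bar>d j\<bar>)"
      using cross[OF that] by (simp add: divide_right_mono)
    also have "\<dots> = w i / \<bar>d i\<bar> * e + w j / \<bar>d j\<bar> * e"
      using d that by (simp add: field_simps)
    finally show ?thesis by (simp add: l_def u_def)
  qed
  then have "l i \<le> Max (l ` S) \<and> Max (l ` S) \<le> u i" if "i \<in> S" for i
    using assms(1,2) that by simp
  then have "\<forall>i\<in>S. \<bar>c i - Max (l ` S) * d i\<bar> \<le> e * w i"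
    using d by (simp add: abs_diff_mult_le_iff l_def u_def)
  then show ?thesis ..
qed

section \<open>Error and parameter bounds as systems of inequalities\<close>

lemma finite_nonzero_pairs: "finite (nonzero_pairs M X)"
  by (rule finite_subset[of _ "{..M} \<times> {..M}"]) (auto simp: nonzero_pairs_def)

lemma finite_distinct_pairs: "finite (distinct_pairs M X)"
  by (rule finite_subset[of _ "{..M} \<times> {..M}"]) (auto simp: distinct_pairs_def)

lemma distinct_pairs_subset: "distinct_pairs M X \<subseteq> nonzero_pairs M X"
  by (auto simp: distinct_pairs_def nonzero_pairs_def)

lemma max_error_le_iff:
  assumes "M > 0"
  shows "max_error M X Y (a, b) \<le> e \<longleftrightarrow> (\<forall>i\<in>{1..M}. \<bar>Y i - a - b * X i\<bar> \<le> e)"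
proof -
  have "\<bar>a + X i * b - Y i\<bar> = \<bar>Y i - a - b * X i\<bar>" for i
    by (simp add: abs_le_iff mult.commute)
  then show ?thesis
    using assms by (simp add: max_error_def)
qed

text \<open>Without distinct pairs the bounds are minus and plus infinity and the right side is
  vacuous, so that case needs no separate treatment.\<close>

lemma intercept_bounds_iff:
  "intercept_lower M X Y e \<le> ereal a \<and> ereal a \<le> intercept_upper M X Y e \<longleftrightarrow>
    (\<forall>(i, k)\<in>distinct_pairs M X.
      \<bar>(Y i * X k - Y k * X i) - a * (X k - X i)\<bar> \<le> e * (\<bar>X i\<bar> + \<bar>X k\<bar>))"
proof -
  have "\<bar>(Y (fst q) * X (snd q) - Y (snd q) * X (fst q)) - a * (X (snd q) - X (fst q))\<bar>
      \<le> e * (\<bar>X (fst q)\<bar> + \<bar>X (snd q)\<bar>) \<longleftrightarrow>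
    - ((\<bar>X (fst q)\<bar> + \<bar>X (snd q)\<bar>) / \<bar>X (snd q) - X (fst q)\<bar>) * e
      + (Y (fst q) * X (snd q) - Y (snd q) * X (fst q)) / (X (snd q) - X (fst q)) \<le> a \<and>
    a \<le> (\<bar>X (fst q)\<bar> + \<bar>X (snd q)\<bar>) / \<bar>X (snd q) - X (fst q)\<bar> * e
      + (Y (fst q) * X (snd q) - Y (snd q) * X (fst q)) / (X (snd q) - X (fst q))"
    if "q \<in> distinct_pairs M X" for q
    using that by (intro abs_diff_mult_le_iff) (auto simp: distinct_pairs_def)
  then show ?thesis
    unfolding intercept_lower_def intercept_upper_def
    by (simp only: SUP_le_iff le_INF_iff split_beta ereal_less_eq ball_conj_distrib cong: ball_cong)
qed

lemma slope_bounds_iff: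
  assumes "\<exists>i\<in>{1..M}. X i \<noteq> 0"
  shows "slope_lower M X Y e a \<le> b \<and> b \<le> slope_upper M X Y e a \<longleftrightarrow>
    (\<forall>i\<in>{1..M}. X i \<noteq> 0 \<longrightarrow> \<bar>Y i - a - b * X i\<bar> \<le> e)"
proof -
  have *: "\<bar>Y i - a - b * X i\<bar> \<le> e \<longleftrightarrow>
      - (e / \<bar>X i\<bar>) - a / X i + Y i / X i \<le> b \<and> b \<le> e / \<bar>X i\<bar> - a / X i + Y i / X i"
    if "X i \<noteq> 0" for i
    using abs_diff_mult_le_iff[OF that, of "Y i - a" b e 1] by (simp add: diff_divide_distrib) linarith
  have "{i\<in>{1..M}. X i \<noteq> 0} \<noteq> {}" using assms by auto
  then show ?thesis
    unfolding slope_lower_def slope_upper_def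
    using * by (subst Max_le_iff, simp, simp, subst Min_ge_iff) auto
qed

section \<open>The quotients in \<open>error_mu\<close>\<close>

lemma error_mu_denominator_pos:
  assumes "(i, k) \<in> nonzero_pairs M X" and "(p, r) \<in> distinct_pairs M X"
  shows "(\<bar>X i\<bar> + \<bar>X k\<bar>) * \<bar>X r - X p\<bar> + (\<bar>X p\<bar> + \<bar>X r\<bar>) * \<bar>X k - X i\<bar> > 0"
proof -
  have "\<bar>X i\<bar> + \<bar>X k\<bar> \<noteq> 0" "X r \<noteq> X p"
    using assms unfolding nonzero_pairs_def distinct_pairs_def by blast+
  then have "\<bar>X i\<bar> + \<bar>X k\<bar> > 0" "\<bar>X r - X p\<bar> > 0"
    by linarith+
  then show ?thesis by (simp add: add_pos_nonneg)
qed

lemma error_mu_le_iff: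
  assumes "distinct_pairs M X \<noteq> {}"
  shows "error_mu M X Y \<le> e \<longleftrightarrow>
    (\<forall>(i, k)\<in>nonzero_pairs M X. \<forall>(p, r)\<in>distinct_pairs M X.
      \<bar>(Y i * X k - Y k * X i) * (X r - X p) - (Y p * X r - Y r * X p) * (X k - X i)\<bar>
      \<le> e * ((\<bar>X i\<bar> + \<bar>X k\<bar>) * \<bar>X r - X p\<bar> + (\<bar>X p\<bar> + \<bar>X r\<bar>) * \<bar>X k - X i\<bar>))"
proof -
  have "nonzero_pairs M X \<noteq> {}"
    using assms distinct_pairs_subset by blast
  then show ?thesis
    using assms error_mu_denominator_pos[of _ _ M X]
    by (auto simp: error_mu_def finite_nonzero_pairs finite_distinct_pairs
        pos_divide_le_eq split_beta)
qed

lemma error_mu_nonneg: "error_mu M X Y \<ge> 0"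
proof (cases "distinct_pairs M X = {}")
  case False
  then obtain i k where ik: "(i, k) \<in> distinct_pairs M X" by auto
  \<comment> \<open>Pairing \<open>(i, k)\<close> with itself makes the numerator vanish.\<close>
  then have "0 \<le> error_mu M X Y * ((\<bar>X i\<bar> + \<bar>X k\<bar>) * \<bar>X k - X i\<bar> + (\<bar>X i\<bar> + \<bar>X k\<bar>) * \<bar>X k - X i\<bar>)"
    using error_mu_le_iff[OF False, of Y "error_mu M X Y"] distinct_pairs_subset[of M X] by fastforce
  moreover have "0 < (\<bar>X i\<bar> + \<bar>X k\<bar>) * \<bar>X k - X i\<bar> + (\<bar>X i\<bar> + \<bar>X k\<bar>) * \<bar>X k - X i\<bar>"
    using ik distinct_pairs_subset by (intro error_mu_denominator_pos) blast+
  ultimately show ?thesis by (metis zero_le_mult_iff not_le)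
qed (simp add: error_mu_def)

section \<open>Necessity: eliminating both unknowns\<close>

lemma abs_cross_le:
  fixes x y u v e :: real
  assumes "\<bar>u\<bar> \<le> e * s" "\<bar>v\<bar> \<le> e * t"
  shows "\<bar>u * y - v * x\<bar> \<le> e * (s * \<bar>y\<bar> + t * \<bar>x\<bar>)"
proof -
  have "\<bar>u * y - v * x\<bar> \<le> \<bar>u\<bar> * \<bar>y\<bar> + \<bar>v\<bar> * \<bar>x\<bar>"
    by (metis abs_triangle_ineq4 abs_mult)
  also have "\<dots> \<le> e * s * \<bar>y\<bar> + e * t * \<bar>x\<bar>"
    using assms by (intro add_mono mult_right_mono) auto
  finally show ?thesis by (simp add: algebra_simps)
qed

text \<open>Multiplying the two residuals by \<open>X k\<close> and \<open>X i\<close> and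
  subtracting cancels \<open>b\<close>.\<close>

lemma strips_pairwise:
  fixes X Y :: "nat \<Rightarrow> real"
  assumes "\<bar>Y i - a - b * X i\<bar> \<le> e" "\<bar>Y k - a - b * X k\<bar> \<le> e"
  shows "\<bar>(Y i * X k - Y k * X i) - a * (X k - X i)\<bar> \<le> e * (\<bar>X i\<bar> + \<bar>X k\<bar>)"
proof -
  have "(Y i * X k - Y k * X i) - a * (X k - X i) = (Y i - a - b * X i) * X k - (Y k - a - b * X k) * X i"
    by (simp add: algebra_simps)
  then show ?thesis
    using abs_cross_le[of _ e 1 _ 1 "X k" "X i"] assms by (simp add: add.commute)
qed

text \<open>The error of \<open>(a, b)\<close> is itself a feasible bound. Eliminating
  \<open>b\<close> and then \<open>a\<close> by cross-multiplication leaves exactly the inequalities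
  that characterize upper bounds of \<open>error_mu\<close>.\<close>

lemma error_mu_le_max_error:
  assumes "M > 0"
  shows "error_mu M X Y \<le> max_error M X Y (a, b)"
proof (cases "distinct_pairs M X = {}")
  case True
  have "\<bar>Y 1 - a - b * X 1\<bar> \<le> max_error M X Y (a, b)"
    using max_error_le_iff[OF assms, of X Y a b "max_error M X Y (a, b)"] assms by simp
  then have "0 \<le> max_error M X Y (a, b)" by linarith
  then show ?thesis using True by (simp add: error_mu_def)
next
  case False
  define e where "e = max_error M X Y (a, b)"
  have e: "\<bar>Y i - a - b * X i\<bar> \<le> e" if "i \<in> {1..M}" for i
    using max_error_le_iff[OF assms, of X Y a b e] that by (auto simp: e_def)
  have pairwise: "\<bar>(Y i * X k - Y k * X i) - a * (X k - X i)\<bar> \<le> e * (\<bar>X i\<bar> + \<bar>X k\<bar>)"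
    if "(i, k) \<in> nonzero_pairs M X" for i k
    using that by (intro strips_pairwise[where b = b] e) (auto simp: nonzero_pairs_def)
  have "\<bar>(Y i * X k - Y k * X i) * (X r - X p) - (Y p * X r - Y r * X p) * (X k - X i)\<bar>
      \<le> e * ((\<bar>X i\<bar> + \<bar>X k\<bar>) * \<bar>X r - X p\<bar> + (\<bar>X p\<bar> + \<bar>X r\<bar>) * \<bar>X k - X i\<bar>)"
    if "(i, k) \<in> nonzero_pairs M X" "(p, r) \<in> distinct_pairs M X" for i k p r
  proof -
    have "(p, r) \<in> nonzero_pairs M X"
      using that(2) distinct_pairs_subset by blast
    from abs_cross_le[OF pairwise[OF that(1)] pairwise[OF this], of "X r - X p" "X k - X i"]
    show ?thesis by (simp add: algebra_simps)
  qed
  then show ?thesis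
    unfolding error_mu_le_iff[OF False] e_def[symmetric] by auto
qed

text \<open>Stated for arbitrary \<open>e\<close>: the bounds describe every sublevel set of the
  objective. At the minimum value this set is the solution set.\<close>

lemma max_error_le_iff_bounds:
  assumes "M > 0" and nz: "\<exists>i\<in>{1..M}. X i \<noteq> 0"
  shows "max_error M X Y (a, b) \<le> e \<longleftrightarrow>
    intercept_lower M X Y e \<le> ereal a \<and> ereal a \<le> intercept_upper M X Y e \<and>
    slope_lower M X Y e a \<le> b \<and> b \<le> slope_upper M X Y e a"
    (is "?L \<longleftrightarrow> ?R")
proof
  assume ?L
  then have e: "\<bar>Y i - a - b * X i\<bar> \<le> e" if "i \<in> {1..M}" for i
    using max_error_le_iff[OF assms(1)] that by blast
  have "\<forall>(i, k)\<in>distinct_pairs M X.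
      \<bar>(Y i * X k - Y k * X i) - a * (X k - X i)\<bar> \<le> e * (\<bar>X i\<bar> + \<bar>X k\<bar>)"
    using strips_pairwise[where b = b] e by (auto simp: distinct_pairs_def)
  then show ?R
    using intercept_bounds_iff[of M X Y e a] slope_bounds_iff[OF nz, of Y e a b] e by blast
next
  assume ?R
  then have pairwise: "\<forall>(i, k)\<in>distinct_pairs M X.
      \<bar>(Y i * X k - Y k * X i) - a * (X k - X i)\<bar> \<le> e * (\<bar>X i\<bar> + \<bar>X k\<bar>)"
    and slope: "\<forall>i\<in>{1..M}. X i \<noteq> 0 \<longrightarrow> \<bar>Y i - a - b * X i\<bar> \<le> e"
    using intercept_bounds_iff[of M X Y e a] slope_bounds_iff[OF nz, of Y e a b] by blast+
  have "\<bar>Y i - a - b * X i\<bar> \<le> e" if i: "i \<in> {1..M}" "X i = 0" for i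
  proof -
    obtain k where k: "k \<in> {1..M}" "X k \<noteq> 0" using nz by blast
    then have "(i, k) \<in> distinct_pairs M X \<or> (k, i) \<in> distinct_pairs M X"
      using i by (cases i k rule: linorder_cases) (auto simp: distinct_pairs_def)
    then have "\<bar>(Y i - a) * X k\<bar> \<le> e * \<bar>X k\<bar>"
      using pairwise i(2) by (auto simp: algebra_simps abs_minus_commute)
    then show ?thesis using k i by (simp add: abs_mult)
  qed
  then show ?L
    unfolding max_error_le_iff[OF assms(1)] using slope by blast
qed

section \<open>Attainment and the solution set\<close>

text \<open>Sufficiency, by back substitution: the inequalities for \<open>error_mu\<close> yield an
  \<open>a\<close>, and with this \<open>a\<close> fixed the strips yield a
  \<open>b\<close>.\<close>

lemma max_error_attains_error_mu:
  assumes "M > 0" and nz: "\<exists>i\<in>{1..M}. X i \<noteq> 0"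
    and const: "(\<forall>i\<in>{1..M}. \<forall>k\<in>{1..M}. X i = X k) \<longrightarrow> (\<forall>i\<in>{1..M}. \<forall>k\<in>{1..M}. Y i = Y k)"
  shows "\<exists>a b. max_error M X Y (a, b) \<le> error_mu M X Y"
proof (cases "distinct_pairs M X = {}")
  case True
  have X: "X i = X k" if "i \<in> {1..M}" "k \<in> {1..M}" for i k
    using True that by (cases i k rule: linorder_cases) (auto simp: distinct_pairs_def)
  have "\<bar>Y i - Y 1\<bar> \<le> error_mu M X Y" if "i \<in> {1..M}" for i
  proof -
    have "1 \<in> {1..M}" using assms(1) by simp
    then have "Y i = Y 1" using X const that by blast
    then show ?thesis using error_mu_nonneg[of M X Y] by simp
  qed
  \<comment> \<open>By \<open>const\<close> all ordinates agree, so a horizontal line fits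
    exactly.\<close>
  then have "max_error M X Y (Y 1, 0) \<le> error_mu M X Y"
    unfolding max_error_le_iff[OF assms(1)] by simp
  then show ?thesis by blast
next
  case False
  define e where "e = error_mu M X Y"
  have mu: "\<bar>(Y i * X k - Y k * X i) * (X r - X p) - (Y p * X r - Y r * X p) * (X k - X i)\<bar>
      \<le> e * ((\<bar>X i\<bar> + \<bar>X k\<bar>) * \<bar>X r - X p\<bar> + (\<bar>X p\<bar> + \<bar>X r\<bar>) * \<bar>X k - X i\<bar>)"
    if "(i, k) \<in> nonzero_pairs M X" "(p, r) \<in> distinct_pairs M X" for i k p r
    using error_mu_le_iff[OF False, of Y e] that unfolding e_def by blast
  have "\<exists>a. \<forall>q\<in>distinct_pairs M X.
      \<bar>(case q of (i, k) \<Rightarrow> Y i * X k - Y k * X i) - a * (case q of (i, k) \<Rightarrow> X k - X i)\<bar>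
      \<le> e * (case q of (i, k) \<Rightarrow> \<bar>X i\<bar> + \<bar>X k\<bar>)"
  proof (rule strips_intersect[OF finite_distinct_pairs False])
    show "(case q of (i, k) \<Rightarrow> X k - X i) \<noteq> 0" if "q \<in> distinct_pairs M X" for q
      using that by (auto simp: distinct_pairs_def)
  qed (use mu distinct_pairs_subset in \<open>fastforce split: prod.splits\<close>)
  then obtain a where a: "\<forall>(i, k)\<in>distinct_pairs M X.
      \<bar>(Y i * X k - Y k * X i) - a * (X k - X i)\<bar> \<le> e * (\<bar>X i\<bar> + \<bar>X k\<bar>)"
    by (auto simp: split_beta)
  define S where "S = {i\<in>{1..M}. X i \<noteq> 0}"
  \<comment> \<open>The choice of \<open>a\<close> covers only pairs with distinct abscissas. For
    equal ones \<open>a\<close> cancels, and the inequality must come from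
    \<open>mu\<close>.\<close>
  have less: "\<bar>(Y i - a) * X k - (Y k - a) * X i\<bar> \<le> e * (\<bar>X i\<bar> + \<bar>X k\<bar>)"
    if "i \<in> S" "k \<in> S" "i < k" for i k
  proof -
    have eq: "(Y i - a) * X k - (Y k - a) * X i = (Y i * X k - Y k * X i) - a * (X k - X i)"
      by (simp add: algebra_simps)
    show ?thesis
    proof (cases "X i = X k")
      case True
      \<comment> \<open>Any distinct pair will do: as \<open>X k - X i\<close> is zero, numerator
        and denominator share the factor \<open>\<bar>X r - X p\<bar>\<close>, which
        cancels.\<close>
      obtain p r where pr: "(p, r) \<in> distinct_pairs M X" using False by auto
      have "(i, k) \<in> nonzero_pairs M X" using that by (auto simp: nonzero_pairs_def S_def)
      from mu[OF this pr] True
      have "\<bar>Y i * X k - Y k * X i\<bar> * \<bar>X r - X p\<bar> \<le> e * (\<bar>X i\<bar> + \<bar>X k\<bar>) * \<bar>X r - X p\<bar>"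
        by (simp add: abs_mult mult.assoc)
      moreover have "\<bar>X r - X p\<bar> > 0" using pr by (auto simp: distinct_pairs_def)
      ultimately have "\<bar>Y i * X k - Y k * X i\<bar> \<le> e * (\<bar>X i\<bar> + \<bar>X k\<bar>)"
        by (rule mult_right_le_imp_le)
      then show ?thesis unfolding eq using True by simp
    next
      case False
      then have "(i, k) \<in> distinct_pairs M X" using that by (auto simp: distinct_pairs_def S_def)
      then show ?thesis unfolding eq using a by blast
    qed
  qed
  have "\<exists>b. \<forall>i\<in>S. \<bar>(Y i - a) - b * X i\<bar> \<le> e * 1"
  proof (rule strips_intersect)
    fix i k assume "i \<in> S" "k \<in> S"
    then show "\<bar>(Y i - a) * X k - (Y k - a) * X i\<bar> \<le> e * (1 * \<bar>X k\<bar> + 1 * \<bar>X i\<bar>)"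
      \<comment> \<open>For \<open>i = k\<close> the left side is zero, which is where nonnegativity
        of \<open>e\<close> enters.\<close>
      using less[of i k] less[of k i] error_mu_nonneg[of M X Y]
      by (cases i k rule: linorder_cases) (simp_all add: e_def add.commute abs_minus_commute)
  qed (use nz in \<open>auto simp: S_def\<close>)
  then obtain b where b: "\<forall>i\<in>S. \<bar>Y i - a - b * X i\<bar> \<le> e" by auto
  have "max_error M X Y (a, b) \<le> e"
    \<comment> \<open>Points outside \<open>S\<close> are handled by the intercept bounds on
      \<open>a\<close>.\<close>
    using intercept_bounds_iff[of M X Y e a] slope_bounds_iff[OF nz, of Y e a b] a b
    unfolding max_error_le_iff_bounds[OF assms(1) nz] S_def by blast
  then show ?thesis unfolding e_def by blast
qed

theorem proposition3:
  fixes M :: nat and X Y :: "nat \<Rightarrow> real"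
  assumes "M > 0"
    and "\<exists>i\<in>{1..M}. X i \<noteq> 0"
    and "(\<forall>i\<in>{1..M}. \<forall>k\<in>{1..M}. X i = X k) \<longrightarrow> (\<forall>i\<in>{1..M}. \<forall>k\<in>{1..M}. Y i = Y k)"
  shows "(\<exists>\<theta>. max_error M X Y \<theta> = error_mu M X Y) \<and>
         (\<forall>\<theta>. error_mu M X Y \<le> max_error M X Y \<theta>) \<and>
         (\<forall>\<theta>\<^sub>1 \<theta>\<^sub>2. is_arg_min (max_error M X Y) (\<lambda>_. True) (\<theta>\<^sub>1, \<theta>\<^sub>2) \<longleftrightarrow>
           intercept_lower M X Y (error_mu M X Y) \<le> ereal \<theta>\<^sub>1 \<and>
           ereal \<theta>\<^sub>1 \<le> intercept_upper M X Y (error_mu M X Y) \<and>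
           slope_lower M X Y (error_mu M X Y) \<theta>\<^sub>1 \<le> \<theta>\<^sub>2 \<and>
           \<theta>\<^sub>2 \<le> slope_upper M X Y (error_mu M X Y) \<theta>\<^sub>1)"
proof -
  have lower: "error_mu M X Y \<le> max_error M X Y \<theta>" for \<theta>
    using error_mu_le_max_error[OF assms(1)] by (cases \<theta>) auto
  obtain \<theta> where \<theta>: "max_error M X Y \<theta> = error_mu M X Y"
    using max_error_attains_error_mu[OF assms] lower by (meson antisym)
  \<comment> \<open>As \<open>error_mu\<close> is attained and is a lower bound, the minimizers form
    its sublevel set.\<close>
  have "is_arg_min (max_error M X Y) (\<lambda>_. True) \<eta> \<longleftrightarrow> max_error M X Y \<eta> \<le> error_mu M X Y" for \<eta>
    unfolding is_arg_min_def using lower \<theta> by (metis not_le order_trans)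
  then show ?thesis
    using lower \<theta> max_error_le_iff_bounds[OF assms(1,2)] by blast
qed

end
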